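(* Suppose that $\mathbb{E}_{\boldsymbol{\Delta}}[\mathcal{Q}_\ell(F_\ell-F_{\ell-1})]=\mathbb{E}[F_\ell-F_{\ell-1}]$ for all $0\le\ell\le L$, and that there are nonnegative constants $\alpha,\alpha',\beta,\beta',\gamma,\lambda$ (with $\lambda>0$) such that for all $0\le \ell\le L$ \begin{itemize} \item[(M1)] $\big|\mathbb{E}[F_L-F]\big|\lesssim h_L^{\alpha}+s_L^{-\alpha'}$, \item[(M2)] $\mathbb{V}_{\boldsymbol{\Delta}}[\mathcal{Q}_\ell(F_\ell-F_{\ell-1})]\lesssim R_\ell^{-1}N_\ell^{-1/\lambda}\big(h_{\ell-1}^{\beta}+(1-\delta_{s_\ell,s_{\ell-1}})\,s_{\ell-1}^{-\beta'}\big)$, \item[(M3)] $\mathrm{cost}(\mathcal{Q}_\ell(F_\ell-F_{\ell-1}))\lesssim R_\ell N_\ell\big(s_\ell h_\ell^{-d}+h_\ell^{-\gamma}\big)$, \end{itemize} where $\delta_{\cdot,\cdot}$ is the Kronecker delta. Then $$e\big(\mathcal{Q}^{\mathrm{ML}}_L(F)\big)^2\lesssim h_L^{2\alpha}+s_L^{-2\alpha'}+\sum_{\ell=0}^L R_\ell^{-1}N_\ell^{-1/\lambda}\big(h_{\ell-1}^{\beta}+(1-\delta_{s_\ell,s_{\ell-1}})\,s_{\ell-1}^{-\beta'}\big)$$ and $$\mathrm{cost}\big(\mathcal{Q}^{\mathrm{ML}}_L(F)\big)\lesssim\sum_{\ell=0}^L R_\ell N_\ell\big(s_\ell h_\ell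^{-d}+h_\ell^{-\gamma}\big).$$
   Context: Let $d\in\{1,2,3\}$. $F$ is an integrable real random variable (quantity of interest). For $\ell=0,\dots,L$ let $h_0>h_1>\dots>h_L>0$ be mesh widths, $s_0\le s_1\le\dots\le s_L$ positive integers (truncation dimensions), and $F_\ell=F_{h_\ell,s_\ell}$ an approximation of $F$ which is a function of $s_\ell$ i.i.d. standard Gaussian variables. Conventions: $F_{-1}:=0$, $h_{-1}:=1$, $s_{-1}:=1$. For positive integers $N_\ell,R_\ell$, the level-$\ell$ estimator of $\mathbb{E}[F_\ell-F_{\ell-1}]$ is the randomly shifted lattice rule $$\mathcal{Q}_\ell(F_\ell-F_{\ell-1})=\frac1{R_\ell}\sum_{k=1}^{R_\ell}\frac1{N_\ell}\sum_{i=1}^{N_\ell}\big(F_\ell(\boldsymbol{y}_\ell^{(i,k)})-F_{\ell-1}(\boldsymbol{y}_\ell^{(i,k)})\big),\qquad \boldsymbol{y}_\ell^{(i,k)}=\boldsymbol{\Phi}_{s_\ell}^{-1}\big(\mathrm{frac}(i\boldsymbol{z}_\ell/N_\ell+\boldsymbol{\Delta}_{\ell,k})\big),$$ where $\boldsymbol{z}_\ell\in\mathbb{N}^{s_\ell}$ is a fixed generating vector, $\mathrm{frac}$ is the componentwise fractional part, $\boldsymbol{\Phi}_{s}^{-1}$ is the inverse standard normal distribution function applied componentwise, and the shifts $\boldsymbol{\Delta}_{\ell,k}$ are uniformly distributed on $[0,1]^{s_\ell}$ and all mutually independent (over $k$ and over $\ell$). ($F_{\ell-1}$ depends only on the first $s_{\ell-1}$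 components.) $\mathbb{E}_{\boldsymbol{\Delta}}$ denotes expectation over the random shifts, and $\mathbb{V}_{\boldsymbol{\Delta}}[\mathcal{Q}_\ell(F_\ell-F_{\ell-1})]:=\mathbb{E}_{\boldsymbol{\Delta}}\big[(\mathcal{Q}_\ell(F_\ell-F_{\ell-1})-\mathbb{E}[F_\ell-F_{\ell-1}])^2\big]$. The multilevel estimator is $\mathcal{Q}^{\mathrm{ML}}_L(F):=\sum_{\ell=0}^L\mathcal{Q}_\ell(F_\ell-F_{\ell-1})$, its root mean square error is $e(\mathcal{Q}^{\mathrm{ML}}_L(F)):=\big(\mathbb{E}_{\boldsymbol{\Delta}}[(\mathcal{Q}^{\mathrm{ML}}_L(F)-\mathbb{E}[F])^2]\big)^{1/2}$, and its cost is the sum of the (nonnegative) level costs, $\mathrm{cost}(\mathcal{Q}^{\mathrm{ML}}_L(F)):=\sum_{\ell=0}^L\mathrm{cost}(\mathcal{Q}_\ell(F_\ell-F_{\ell-1}))$. $A\lesssim B$ means $A\le cB$ for a constant $c>0$ independent of $\ell$, $L$ and of all $h_\ell,s_\ell,N_\ell,R_\ell$. *)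

theory Defs
  imports "HOL-Probability.Probability"
begin

text \<open>
  A discretisation collects everything the implied constants must not depend on: the number of
  levels, the mesh widths, truncation dimensions, numbers of lattice points and of random shifts,
  the generating vectors, the random shifts with the probability space carrying them, and the costs
  of the level estimators. A bound with an implied constant is a bound with one constant for all
  members of a set of discretisations. A vector of dimension \<open>s\<close> is an element of
  \<open>{..<s} \<rightarrow>\<^sub>E UNIV\<close>; its components are numbered from 0.
\<close>

record 'b discretisation =
  top_level :: nat
  mesh_width :: "nat \<Rightarrow> real"
  trunc_dim :: "nat \<Rightarrow> nat"
  num_points :: "nat \<Rightarrow> nat"
  num_shifts :: "nat \<Rightarrow> nat"
  gen_vector :: "nat \<Rightarrow> nat \<Rightarrow> nat"
  shift_space :: "'b measure"
  shift :: "nat \<Rightarrow> nat \<Rightarrow> 'b \<Rightarrow> nat \<Rightarrow> real"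
  level_cost :: "nat \<Rightarrow> real"

definition valid_discretisation :: "'b discretisation \<Rightarrow> bool" where
  "valid_discretisation p \<longleftrightarrow>
     (\<forall>l<top_level p. mesh_width p (Suc l) < mesh_width p l) \<and>
     0 < mesh_width p (top_level p) \<and>
     (\<forall>l<top_level p. trunc_dim p l \<le> trunc_dim p (Suc l)) \<and>
     (\<forall>l\<le>top_level p. 0 < trunc_dim p l \<and> 0 < num_points p l \<and> 0 < num_shifts p l
        \<and> 0 \<le> level_cost p l) \<and>
     prob_space (shift_space p) \<and>
     prob_space.indep_vars (shift_space p)
       (\<lambda>(l, k). \<Pi>\<^sub>M j\<in>{..<trunc_dim p l}. borel) (\<lambda>(l, k). shift p l k)
       (SIGMA l:{..top_level p}. {1..num_shifts p l}) \<and>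
     (\<forall>l\<le>top_level p. \<forall>k\<in>{1..num_shifts p l}.
        distr (shift_space p) (\<Pi>\<^sub>M j\<in>{..<trunc_dim p l}. borel) (shift p l k) =
        (\<Pi>\<^sub>M j\<in>{..<trunc_dim p l}. uniform_measure lborel {0..1}))"

definition prev_mesh_width :: "'b discretisation \<Rightarrow> nat \<Rightarrow> real" where
  "prev_mesh_width p l = (if l = 0 then 1 else mesh_width p (l - 1))"

definition prev_trunc_dim :: "'b discretisation \<Rightarrow> nat \<Rightarrow> nat" where
  "prev_trunc_dim p l = (if l = 0 then 1 else trunc_dim p (l - 1))"

text \<open>
  \<open>A h s\<close> is the approximation with mesh width \<open>h\<close> and truncation dimension \<open>s\<close>, as a function
  of an \<open>s\<close>-dimensional vector. In \<open>approx\<close> the vector \<open>y\<close> may be longer (or infinite): only its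
  first components are used.
\<close>

definition approx ::
  "(real \<Rightarrow> nat \<Rightarrow> (nat \<Rightarrow> real) \<Rightarrow> real) \<Rightarrow> 'b discretisation \<Rightarrow> nat \<Rightarrow> (nat \<Rightarrow> real) \<Rightarrow> real" where
  "approx A p l y = A (mesh_width p l) (trunc_dim p l) (restrict y {..<trunc_dim p l})"

definition approx_diff ::
  "(real \<Rightarrow> nat \<Rightarrow> (nat \<Rightarrow> real) \<Rightarrow> real) \<Rightarrow> 'b discretisation \<Rightarrow> nat \<Rightarrow> (nat \<Rightarrow> real) \<Rightarrow> real" where
  "approx_diff A p l y = approx A p l y - (if l = 0 then 0 else approx A p (l - 1) y)"

definition std_normal_quantile :: "real \<Rightarrow> real" where
  \<comment> \<open>The value outside \<open>{0<..<1}\<close> is unspecified; below, the argument 0 occurs with probability 0.\<close>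
  "std_normal_quantile = inv (cdf std_normal_distribution)"

definition lattice_point :: "'b discretisation \<Rightarrow> nat \<Rightarrow> nat \<Rightarrow> nat \<Rightarrow> 'b \<Rightarrow> nat \<Rightarrow> real" where
  "lattice_point p l i k \<theta> = (\<lambda>j\<in>{..<trunc_dim p l}.
     std_normal_quantile
       (frac (real i * real (gen_vector p l j) / real (num_points p l) + shift p l k \<theta> j)))"

definition level_estimator ::
  "(real \<Rightarrow> nat \<Rightarrow> (nat \<Rightarrow> real) \<Rightarrow> real) \<Rightarrow> 'b discretisation \<Rightarrow> nat \<Rightarrow> 'b \<Rightarrow> real" where
  "level_estimator A p l \<theta> =
     1 / real (num_shifts p l) * (\<Sum>k = 1..num_shifts p l.
       1 / real (num_points p l) * (\<Sum>i = 1..num_points p l.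
         approx_diff A p l (lattice_point p l i k \<theta>)))"

definition ml_estimator ::
  "(real \<Rightarrow> nat \<Rightarrow> (nat \<Rightarrow> real) \<Rightarrow> real) \<Rightarrow> 'b discretisation \<Rightarrow> 'b \<Rightarrow> real" where
  "ml_estimator A p \<theta> = (\<Sum>l = 0..top_level p. level_estimator A p l \<theta>)"

definition ml_cost :: "'b discretisation \<Rightarrow> real" where
  "ml_cost p = (\<Sum>l = 0..top_level p. level_cost p l)"

text \<open>
  Mean square deviation of an estimator from a target value \<open>m\<close> over the random shifts. It takes
  values in \<open>[0, \<infinity>]\<close>, so an upper bound entails square integrability. With
  \<open>m\<close> the expectation of the level difference it is the variance of a level estimator.
\<close>

definition mean_square_dev :: "'b discretisation \<Rightarrow> ('b \<Rightarrow> real) \<Rightarrow> real \<Rightarrow> ennreal" where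
  "mean_square_dev p Q m = (\<integral>\<^sup>+ \<theta>. ennreal ((Q \<theta> - m)\<^sup>2) \<partial>shift_space p)"

definition ennreal_sqrt :: "ennreal \<Rightarrow> ennreal" where
  "ennreal_sqrt x = (if x = \<top> then \<top> else ennreal (sqrt (enn2real x)))"

definition expected_diff ::
  "'a measure \<Rightarrow> (nat \<Rightarrow> 'a \<Rightarrow> real) \<Rightarrow> (real \<Rightarrow> nat \<Rightarrow> (nat \<Rightarrow> real) \<Rightarrow> real) \<Rightarrow>
   'b discretisation \<Rightarrow> nat \<Rightarrow> real" where
  "expected_diff M Y A p l = (\<integral>\<omega>. approx_diff A p l (\<lambda>j. Y j \<omega>) \<partial>M)"

definition level_variance ::
  "'a measure \<Rightarrow> (nat \<Rightarrow> 'a \<Rightarrow> real) \<Rightarrow> (real \<Rightarrow> nat \<Rightarrow> (nat \<Rightarrow> real) \<Rightarrow> real) \<Rightarrow>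
   'b discretisation \<Rightarrow> nat \<Rightarrow> ennreal" where
  "level_variance M Y A p l =
     mean_square_dev p (level_estimator A p l) (expected_diff M Y A p l)"

definition ml_rmse ::
  "'a measure \<Rightarrow> ('a \<Rightarrow> real) \<Rightarrow> (real \<Rightarrow> nat \<Rightarrow> (nat \<Rightarrow> real) \<Rightarrow> real) \<Rightarrow>
   'b discretisation \<Rightarrow> ennreal" where
  "ml_rmse M F A p = ennreal_sqrt (mean_square_dev p (ml_estimator A p) (\<integral>\<omega>. F \<omega> \<partial>M))"

definition variance_rate :: "real \<Rightarrow> real \<Rightarrow> real \<Rightarrow> 'b discretisation \<Rightarrow> nat \<Rightarrow> real" where
  "variance_rate \<beta> \<beta>' lam p l =
     1 / real (num_shifts p l) * real (num_points p l) powr (- 1 / lam) *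
     (prev_mesh_width p l powr \<beta> +
      (1 - (if trunc_dim p l = prev_trunc_dim p l then 1 else 0)) *
        real (prev_trunc_dim p l) powr (- \<beta>'))"

definition cost_rate :: "nat \<Rightarrow> real \<Rightarrow> 'b discretisation \<Rightarrow> nat \<Rightarrow> real" where
  "cost_rate d \<gamma> p l =
     real (num_shifts p l) * real (num_points p l) *
     (real (trunc_dim p l) * mesh_width p l powr (- real d) + mesh_width p l powr (- \<gamma>))"

end

theory Submission
  imports Defs
begin

text \<open>
  Unbiasedness of the level estimators makes the bias of the multilevel estimator telescope to
  \<open>\<bbbE>[F\<^sub>L - F]\<close>. Estimators on different levels are functions of disjoint families of independent
  shifts, so the mean square error is exactly the squared bias plus the sum of the level variances.
  The first is bounded by (M1) and \<open>(a + b)\<^sup>2 \<le> 2 (a\<^sup>2 + b\<^sup>2)\<close>, the second by (M2).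
\<close>

section \<open>Preliminaries: squared errors, nonnegative rates, measurability of the normal
  quantile\<close>

text \<open>The infinite case is consistent because the square of \<open>\<top>\<close> is
  \<open>\<top>\<close>. The squared root mean square error can thus be replaced by the mean square
  deviation before finiteness is known.\<close>

lemma ennreal_sqrt_power2: "(ennreal_sqrt x)\<^sup>2 = x"
  by (cases x) (simp_all add: ennreal_sqrt_def ennreal_power power2_eq_square ennreal_top_mult
    flip: ennreal_mult)

lemma variance_rate_nonneg: "0 \<le> variance_rate \<beta> \<beta>' lam p l"
  unfolding variance_rate_def by simp

text \<open>
  No strict monotonicity of the distribution function is needed: any right inverse of a monotone
  function is monotone on the range, and \<open>inv\<close> is constant off the range.
\<close>

lemma borel_measurable_std_normal_quantile [measurable]:
  "std_normal_quantile \<in> borel_measurable borel"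
proof -
  let ?f = "cdf std_normal_distribution"
  interpret real_distribution std_normal_distribution
    by (rule real_dist_normal_dist)
  \<comment> \<open>A measure with a Lebesgue density has no atoms, so the distribution function is
    continuous. Its range is then connected, hence an interval, hence Borel.\<close>
  have "emeasure std_normal_distribution {x} = 0" for x
    by (subst emeasure_density)
       (auto intro!: nn_integral_0_iff_AE[THEN iffD2] AE_lborel_singleton[THEN AE_mp])
  then have "isCont ?f x" for x
    by (simp add: isCont_cdf measure_def)
  then have "continuous_on UNIV ?f"
    by (simp add: continuous_at_imp_continuous_on)
  then have "connected (range ?f)"
    by (intro connected_continuous_image) auto
  then have range: "range ?f \<in> sets borel"
    by (intro real_interval_borel_measurable) (simp add: is_interval_connected_1)
  have "mono_on (range ?f) (inv ?f)"
  proof (rule mono_onI)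
    fix u v assume uv: "u \<in> range ?f" "v \<in> range ?f" "u \<le> v"
    show "inv ?f u \<le> inv ?f v"
    proof (cases "u = v")
      case False
      \<comment> \<open>The right inverse property turns the negated inequality into
        \<open>\<not> v \<le> u\<close>, which holds since \<open>u \<le> v\<close> and
        \<open>u \<noteq> v\<close>. Monotonicity of the distribution function, read
        contrapositively, then orders the preimages.\<close>
      then have "\<not> ?f (inv ?f v) \<le> ?f (inv ?f u)"
        using uv by (simp add: f_inv_into_f)
      then show ?thesis
        using cdf_nondecreasing[of "inv ?f v" "inv ?f u"] by (meson linear)
    qed simp
  qed
  then have 1: "inv ?f \<in> borel_measurable (restrict_space borel (range ?f))"
    by (rule borel_measurable_mono_on_fnc)
  have "inv ?f u = inv ?f v" if "u \<notin> range ?f" "v \<notin> range ?f" for u v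
  proof -
    \<comment> \<open>Both predicates are identically false off the range, so the choice operator
      behind \<open>inv\<close> returns the same value for them.\<close>
    have "(\<lambda>x. ?f x = u) = (\<lambda>x. ?f x = v)"
      using that by auto
    then show ?thesis
      by (simp add: inv_def)
  qed
  then obtain c where c: "\<And>u. u \<notin> range ?f \<Longrightarrow> inv ?f u = c"
    by metis
  have 2: "inv ?f \<in> borel_measurable (restrict_space borel (- range ?f))"
    by (rule measurable_cong[THEN iffD2, OF _ measurable_const[of c]])
       (auto simp: space_restrict_space c)
  have "inv ?f \<in> borel_measurable borel"
    by (rule measurable_piecewise_restrict[of "{range ?f, - range ?f}"])
       (use range 1 2 in auto)
  then show ?thesis
    by (simp add: std_normal_quantile_def)
qed

lemma borel_measurable_frac: "(frac :: real \<Rightarrow> real) \<in> borel_measurable borel"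
  unfolding frac_def[abs_def] by measurable

section \<open>Second moments of sums of independent centred variables\<close>

text \<open>In the expanded square the off-diagonal products factor by independence and vanish by
  centring, as does the term linear in \<open>b\<close>. The offset \<open>b\<close> will be the
  bias of the multilevel estimator.\<close>

lemma (in prob_space) centered_indep_sum_square:
  fixes X :: "'i \<Rightarrow> 'a \<Rightarrow> real"
  assumes I: "finite I"
    and indep: "indep_vars (\<lambda>_. borel) X I"
    and square: "\<And>i. i \<in> I \<Longrightarrow> integrable M (\<lambda>x. (X i x)\<^sup>2)"
    and centered: "\<And>i. i \<in> I \<Longrightarrow> expectation (X i) = 0"
  shows "integrable M (\<lambda>x. ((\<Sum>i\<in>I. X i x) + b)\<^sup>2)" (is ?int)
    and "expectation (\<lambda>x. ((\<Sum>i\<in>I. X i x) + b)\<^sup>2) =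
      (\<Sum>i\<in>I. expectation (\<lambda>x. (X i x)\<^sup>2)) + b\<^sup>2" (is ?eq)
proof -
  have int: "integrable M (X i)" if "i \<in> I" for i
  proof (rule square_integrable_imp_integrable[OF _ square[OF that]])
    show "X i \<in> borel_measurable M"
      using indep that by (simp add: indep_vars_def)
  qed
  \<comment> \<open>On the diagonal, integrability is the assumption on the squares; off it, the
    two-element subfamily is independent, so the product of integrable factors is
    integrable.\<close>
  have mixed: "integrable M (\<lambda>x. X i x * X j x) \<and>
      expectation (\<lambda>x. X i x * X j x) = (if i = j then expectation (\<lambda>x. (X i x)\<^sup>2) else 0)"
    if ij: "i \<in> I" "j \<in> I" for i j
  proof (cases "i = j")
    case True
    then show ?thesis using square[OF ij(1)] by (simp add: power2_eq_square)
  next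
    case False
    have ind: "indep_vars (\<lambda>_. borel) X {i, j}"
      using indep by (rule indep_vars_subset) (use ij in auto)
    have "integrable M (\<lambda>x. \<Prod>k\<in>{i, j}. X k x)"
      by (rule indep_vars_integrable[OF _ ind]) (use int ij in auto)
    moreover have "expectation (\<lambda>x. \<Prod>k\<in>{i, j}. X k x) = (\<Prod>k\<in>{i, j}. expectation (X k))"
      by (rule indep_vars_lebesgue_integral[OF _ ind]) (use int ij in auto)
    ultimately show ?thesis
      using False centered[OF ij(1)] by simp
  qed
  have expand: "((\<Sum>i\<in>I. X i x) + b)\<^sup>2 =
      (\<Sum>i\<in>I. \<Sum>j\<in>I. X i x * X j x) + (2 * b * (\<Sum>i\<in>I. X i x) + b\<^sup>2)" for x
    by (simp add: power2_sum power2_eq_square[of "sum _ _"] sum_product)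
  show ?int
    unfolding expand
    by (intro Bochner_Integration.integrable_add Bochner_Integration.integrable_sum
        integrable_mult_right mixed[THEN conjunct1] int integrable_const)
  have "expectation (\<lambda>x. ((\<Sum>i\<in>I. X i x) + b)\<^sup>2) =
      (\<Sum>i\<in>I. \<Sum>j\<in>I. expectation (\<lambda>x. X i x * X j x)) +
      (2 * b * (\<Sum>i\<in>I. expectation (X i)) + b\<^sup>2)"
    unfolding expand using mixed[THEN conjunct1] int
    by (simp add: Bochner_Integration.integral_add Bochner_Integration.integral_sum
        Bochner_Integration.integrable_sum prob_space cong: sum.cong)
  \<comment> \<open>The case distinction in \<open>mixed\<close> acts as a Kronecker delta and
    collapses the double sum to its diagonal.\<close>
  also have "\<dots> = (\<Sum>i\<in>I. expectation (\<lambda>x. (X i x)\<^sup>2)) + b\<^sup>2"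
    using mixed centered I by (simp add: sum.delta)
  finally show ?eq .
qed

section \<open>Measurability and independence of the level estimators\<close>

lemma approx_diff_measurable:
  assumes dim: "l \<noteq> 0 \<Longrightarrow> trunc_dim p (l - 1) \<le> trunc_dim p l"
    and A: "\<And>m. m \<le> l \<Longrightarrow>
      A (mesh_width p m) (trunc_dim p m) \<in> borel_measurable (\<Pi>\<^sub>M j\<in>{..<trunc_dim p m}. borel)"
  shows "approx_diff A p l \<in> borel_measurable (\<Pi>\<^sub>M j\<in>{..<trunc_dim p l}. borel)"
proof -
  have "approx A p m \<in> borel_measurable (\<Pi>\<^sub>M j\<in>{..<trunc_dim p l}. borel)"
    if "m \<le> l" "trunc_dim p m \<le> trunc_dim p l" for m
    unfolding approx_def
    by (rule measurable_compose[OF measurable_restrict_subset A]) (use that in auto)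
  then show ?thesis
    unfolding approx_diff_def using dim by (cases "l = 0") (auto intro!: borel_measurable_diff)
qed

text \<open>The index pairs of the jointly independent shifts split into one block per level, and
  each level estimator is a measurable function of its own block.\<close>

lemma indep_level_estimators:
  assumes valid: "valid_discretisation p"
    and A: "\<And>l. l \<le> top_level p \<Longrightarrow>
      A (mesh_width p l) (trunc_dim p l) \<in> borel_measurable (\<Pi>\<^sub>M j\<in>{..<trunc_dim p l}. borel)"
  shows "prob_space.indep_vars (shift_space p) (\<lambda>_. borel) (level_estimator A p) {0..top_level p}"
proof -
  interpret prob_space "shift_space p"
    using valid by (simp add: valid_discretisation_def)
  define I where "I = (SIGMA l:{..top_level p}. {1..num_shifts p l})"
  define N where "N = (\<lambda>(l, k :: nat). \<Pi>\<^sub>M j\<in>{..<trunc_dim p l}. (borel :: real measure))"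
  define K where "K l = {l} \<times> {1..num_shifts p l}" for l
  \<comment> \<open>\<open>G l\<close> is the level estimator with the random shifts replaced by a
    free argument, so that measurability can be checked on the product space of one block.\<close>
  define G where "G l x = 1 / real (num_shifts p l) * (\<Sum>k = 1..num_shifts p l.
       1 / real (num_points p l) * (\<Sum>i = 1..num_points p l.
         approx_diff A p l (\<lambda>j\<in>{..<trunc_dim p l}. std_normal_quantile
           (frac (real i * real (gen_vector p l j) / real (num_points p l) + x (l, k) j)))))"
    for l and x :: "nat \<times> nat \<Rightarrow> nat \<Rightarrow> real"
  have indep: "indep_vars N (\<lambda>(l, k). shift p l k) I"
    using valid unfolding valid_discretisation_def I_def N_def by blast
  have "indep_vars (\<lambda>l. PiM (K l) N)
      (\<lambda>l \<theta>. restrict (\<lambda>i. (case i of (l, k) \<Rightarrow> shift p l k) \<theta>) (K l)) {0..top_level p}"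
    by (rule indep_vars_restrict[OF indep]) (auto simp: K_def I_def disjoint_family_on_def)
  moreover have "G l \<in> borel_measurable (PiM (K l) N)" if l: "l \<in> {0..top_level p}" for l
  proof -
    \<comment> \<open>Validity compares a level below the top with its successor, so it is applied
      at \<open>l - 1\<close>.\<close>
    have dim: "trunc_dim p (l - 1) \<le> trunc_dim p l" if "l \<noteq> 0"
      using valid l that unfolding valid_discretisation_def
      by (metis Suc_pred' atLeastAtMost_iff bot_nat_0.not_eq_extremum less_eq_Suc_le)
    have diff: "approx_diff A p l \<in> borel_measurable (\<Pi>\<^sub>M j\<in>{..<trunc_dim p l}. borel)"
      by (rule approx_diff_measurable) (use l dim A in auto)
    \<comment> \<open>Two projections are composed: first onto the shift with index
      \<open>(l, k)\<close>, then onto its component \<open>j\<close>.\<close>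
    have comp: "(\<lambda>x. x (l, k) j) \<in> borel_measurable (PiM (K l) N)"
      if "k \<in> {1..num_shifts p l}" "j < trunc_dim p l" for k j
    proof -
      have "(\<lambda>x. x (l, k)) \<in> measurable (PiM (K l) N) (N (l, k))"
        using that by (intro measurable_component_singleton) (auto simp: K_def)
      then have "(\<lambda>x. x (l, k)) \<in>
          measurable (PiM (K l) N) (\<Pi>\<^sub>M j\<in>{..<trunc_dim p l}. (borel :: real measure))"
        by (simp add: N_def)
      from measurable_compose[OF this measurable_component_singleton[of j]] that show ?thesis
        by simp
    qed
    have "(\<lambda>x. \<lambda>j\<in>{..<trunc_dim p l}. std_normal_quantile
           (frac (real i * real (gen_vector p l j) / real (num_points p l) + x (l, k) j)))
        \<in> measurable (PiM (K l) N) (\<Pi>\<^sub>M j\<in>{..<trunc_dim p l}. borel)"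
      if "k \<in> {1..num_shifts p l}" for i k
    proof (rule measurable_restrict)
      fix j assume "j \<in> {..<trunc_dim p l}"
      then have [measurable]: "(\<lambda>x. x (l, k) j) \<in> borel_measurable (PiM (K l) N)"
        using comp that by simp
      show "(\<lambda>x. std_normal_quantile
           (frac (real i * real (gen_vector p l j) / real (num_points p l) + x (l, k) j)))
        \<in> borel_measurable (PiM (K l) N)"
        by (rule measurable_compose[OF measurable_compose[OF _ borel_measurable_frac]
              borel_measurable_std_normal_quantile]) simp
    qed
    from measurable_compose[OF this diff] show ?thesis
      unfolding G_def by (intro borel_measurable_times borel_measurable_const borel_measurable_sum)
  qed
  ultimately have "indep_vars (\<lambda>_. borel)
      (\<lambda>l \<theta>. G l (restrict (\<lambda>i. (case i of (l, k) \<Rightarrow> shift p l k) \<theta>) (K l))) {0..top_level p}"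
    by (rule indep_vars_compose2)
  \<comment> \<open>The restriction to \<open>K l\<close> disappears because the sum in
    \<open>G l\<close> reads only the shifts with index in that block.\<close>
  also have "(\<lambda>l \<theta>. G l (restrict (\<lambda>i. (case i of (l, k) \<Rightarrow> shift p l k) \<theta>) (K l))) =
      level_estimator A p"
    by (intro ext) (simp add: G_def K_def level_estimator_def lattice_point_def)
  finally show ?thesis .
qed

section \<open>Mean square error of the multilevel estimator\<close>

text \<open>The error is a sum of independent centred level errors plus a constant bias, which
  reduces the claim to the second moment computed above. The finiteness assumption supplies the
  square integrability of the level errors.\<close>

lemma mean_square_dev_ml_estimator:
  assumes valid: "valid_discretisation p"
    and A: "\<And>l. l \<le> top_level p \<Longrightarrow>
      A (mesh_width p l) (trunc_dim p l) \<in> borel_measurable (\<Pi>\<^sub>M j\<in>{..<trunc_dim p l}. borel)"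
    and mean: "\<And>l. l \<le> top_level p \<Longrightarrow> (\<integral>\<theta>. level_estimator A p l \<theta> \<partial>shift_space p) = m l"
    and finite: "\<And>l. l \<le> top_level p \<Longrightarrow> mean_square_dev p (level_estimator A p l) (m l) < \<top>"
  shows "mean_square_dev p (ml_estimator A p) r =
    (\<Sum>l = 0..top_level p. mean_square_dev p (level_estimator A p l) (m l)) +
    ennreal (((\<Sum>l = 0..top_level p. m l) - r)\<^sup>2)"
proof -
  interpret prob_space "shift_space p"
    using valid by (simp add: valid_discretisation_def)
  let ?I = "{0..top_level p}"
  define X where "X l \<theta> = level_estimator A p l \<theta> - m l" for l \<theta>
  define b where "b = (\<Sum>l\<in>?I. m l) - r"
  have "indep_vars (\<lambda>_. borel) (\<lambda>l \<theta>. (\<lambda>x. x - m l) (level_estimator A p l \<theta>)) ?I"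
    by (rule indep_vars_compose2[OF indep_level_estimators[OF valid A]]) auto
  then have indep: "indep_vars (\<lambda>_. borel) X ?I"
    by (simp add: X_def[abs_def])
  then have X_meas: "X l \<in> borel_measurable (shift_space p)" if "l \<in> ?I" for l
    using that by (auto simp: indep_vars_def)
  have square: "integrable (shift_space p) (\<lambda>\<theta>. (X l \<theta>)\<^sup>2)" if "l \<in> ?I" for l
  proof (rule integrableI_nonneg)
    show "(\<lambda>\<theta>. (X l \<theta>)\<^sup>2) \<in> borel_measurable (shift_space p)"
      using X_meas[OF that] by (rule borel_measurable_power)
    show "(\<integral>\<^sup>+ \<theta>. ennreal ((X l \<theta>)\<^sup>2) \<partial>shift_space p) < \<infinity>"
      using finite[of l] that by (simp add: mean_square_dev_def X_def)
  qed simp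
  have centered: "expectation (X l) = 0" if l: "l \<in> ?I" for l
  proof -
    have "integrable (shift_space p) (X l)"
      by (rule square_integrable_imp_integrable[OF X_meas[OF l] square[OF l]])
    \<comment> \<open>The value in \<open>mean\<close> alone does not give integrability, since the
      Bochner integral of a non-integrable function is 0 by default. Here it comes from square
      integrability on a probability space, and only then can the integral of the difference be
      split.\<close>
    then have "integrable (shift_space p) (\<lambda>\<theta>. X l \<theta> + m l)"
      by simp
    then show ?thesis
      using mean[of l] l by (simp add: X_def[abs_def] prob_space)
  qed
  have "ml_estimator A p \<theta> - r = (\<Sum>l\<in>?I. X l \<theta>) + b" for \<theta>
    by (simp add: ml_estimator_def X_def b_def sum_subtractf)
  then have "mean_square_dev p (ml_estimator A p) r =
      ennreal (expectation (\<lambda>\<theta>. ((\<Sum>l\<in>?I. X l \<theta>) + b)\<^sup>2))"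
    unfolding mean_square_dev_def
    by (simp only:, intro nn_integral_eq_integral
        centered_indep_sum_square(1)[OF _ indep square centered]) auto
  also have "\<dots> = ennreal ((\<Sum>l\<in>?I. expectation (\<lambda>\<theta>. (X l \<theta>)\<^sup>2)) + b\<^sup>2)"
    by (intro arg_cong[of _ _ ennreal] centered_indep_sum_square(2)[OF _ indep square centered]) auto
  also have "\<dots> = (\<Sum>l\<in>?I. ennreal (expectation (\<lambda>\<theta>. (X l \<theta>)\<^sup>2))) + ennreal (b\<^sup>2)"
    by (simp add: sum_nonneg)
  also have "(\<Sum>l\<in>?I. ennreal (expectation (\<lambda>\<theta>. (X l \<theta>)\<^sup>2))) =
      (\<Sum>l\<in>?I. mean_square_dev p (level_estimator A p l) (m l))"
    using square by (intro sum.cong) (simp_all add: nn_integral_eq_integral mean_square_dev_def X_def)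
  finally show ?thesis
    by (simp add: b_def)
qed

text \<open>The sum telescopes, starting from the value 0 subtracted at level 0; integrability
  allows the expectation of each difference to be split.\<close>

lemma sum_expected_diff:
  assumes "\<And>l. l \<le> L \<Longrightarrow> integrable M (\<lambda>\<omega>. approx A p l (\<lambda>j. Y j \<omega>))"
  shows "(\<Sum>l = 0..L. expected_diff M Y A p l) = (\<integral>\<omega>. approx A p L (\<lambda>j. Y j \<omega>) \<partial>M)"
  using assms
proof (induction L)
  case 0
  then show ?case by (simp add: expected_diff_def approx_diff_def)
next
  case (Suc L)
  then show ?case by (simp add: expected_diff_def approx_diff_def)
qed

section \<open>Assembly of the error and cost bounds\<close>

theorem theorem1:
  fixes M :: "'a measure" and F :: "'a \<Rightarrow> real" and Y :: "nat \<Rightarrow> 'a \<Rightarrow> real"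
    and A :: "real \<Rightarrow> nat \<Rightarrow> (nat \<Rightarrow> real) \<Rightarrow> real"
    and P :: "'b discretisation set"
    and d :: nat and \<alpha> \<alpha>' \<beta> \<beta>' \<gamma> lam :: real
  assumes d: "d \<in> {1, 2, 3}"
    and prob: "prob_space M"
    and F: "integrable M F"
    and valid: "\<And>p. p \<in> P \<Longrightarrow> valid_discretisation p"
    and Y_indep: "\<And>p. p \<in> P \<Longrightarrow>
      prob_space.indep_vars M (\<lambda>_. borel) Y {..<trunc_dim p (top_level p)}"
    and Y_normal: "\<And>p j. p \<in> P \<Longrightarrow> j < trunc_dim p (top_level p) \<Longrightarrow>
      distributed M lborel (Y j) std_normal_density"
    and A_measurable: "\<And>p l. p \<in> P \<Longrightarrow> l \<le> top_level p \<Longrightarrow>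
      A (mesh_width p l) (trunc_dim p l) \<in> borel_measurable (\<Pi>\<^sub>M j\<in>{..<trunc_dim p l}. borel)"
    and A_integrable: "\<And>p l. p \<in> P \<Longrightarrow> l \<le> top_level p \<Longrightarrow>
      integrable M (\<lambda>\<omega>. approx A p l (\<lambda>j. Y j \<omega>))"
    and unbiased: "\<And>p l. p \<in> P \<Longrightarrow> l \<le> top_level p \<Longrightarrow>
      (\<integral>\<theta>. level_estimator A p l \<theta> \<partial>shift_space p) = expected_diff M Y A p l"
    and nonneg: "0 \<le> \<alpha>" "0 \<le> \<alpha>'" "0 \<le> \<beta>" "0 \<le> \<beta>'" "0 \<le> \<gamma>" "0 < lam"
    and M1: "\<exists>c>0. \<forall>p\<in>P.
      \<bar>\<integral>\<omega>. approx A p (top_level p) (\<lambda>j. Y j \<omega>) - F \<omega> \<partial>M\<bar>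
        \<le> c * (mesh_width p (top_level p) powr \<alpha> + real (trunc_dim p (top_level p)) powr (- \<alpha>'))"
    and M2: "\<exists>c>0. \<forall>p\<in>P. \<forall>l\<le>top_level p.
      level_variance M Y A p l \<le> ennreal (c * variance_rate \<beta> \<beta>' lam p l)"
    and M3: "\<exists>c>0. \<forall>p\<in>P. \<forall>l\<le>top_level p.
      level_cost p l \<le> c * cost_rate d \<gamma> p l"
  shows "(\<exists>c>0. \<forall>p\<in>P.
      (ml_rmse M F A p)\<^sup>2
        \<le> ennreal (c * (mesh_width p (top_level p) powr (2 * \<alpha>)
            + real (trunc_dim p (top_level p)) powr (- 2 * \<alpha>')
            + (\<Sum>l = 0..top_level p. variance_rate \<beta> \<beta>' lam p l)))) \<and>
    (\<exists>c>0. \<forall>p\<in>P.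
      ml_cost p \<le> c * (\<Sum>l = 0..top_level p. cost_rate d \<gamma> p l))"
proof
  obtain c1 where c1: "c1 > 0" "\<And>p. p \<in> P \<Longrightarrow>
      \<bar>\<integral>\<omega>. approx A p (top_level p) (\<lambda>j. Y j \<omega>) - F \<omega> \<partial>M\<bar>
        \<le> c1 * (mesh_width p (top_level p) powr \<alpha> + real (trunc_dim p (top_level p)) powr (- \<alpha>'))"
    using M1 by blast
  obtain c2 where c2: "c2 > 0" "\<And>p l. p \<in> P \<Longrightarrow> l \<le> top_level p \<Longrightarrow>
      level_variance M Y A p l \<le> ennreal (c2 * variance_rate \<beta> \<beta>' lam p l)"
    using M2 by blast
  show "\<exists>c>0. \<forall>p\<in>P. (ml_rmse M F A p)\<^sup>2
        \<le> ennreal (c * (mesh_width p (top_level p) powr (2 * \<alpha>)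
            + real (trunc_dim p (top_level p)) powr (- 2 * \<alpha>')
            + (\<Sum>l = 0..top_level p. variance_rate \<beta> \<beta>' lam p l)))"
  \<comment> \<open>The squared bias costs \<open>2 * c1\<^sup>2\<close> and the variances cost
    \<open>c2\<close>; their sum dominates both and is independent of \<open>p\<close>.\<close>
  proof (intro exI[of _ "2 * c1\<^sup>2 + c2"] conjI ballI)
    show "0 < 2 * c1\<^sup>2 + c2"
      using c1(1) c2(1) by (simp add: add_nonneg_pos)
    fix p assume p: "p \<in> P"
    let ?L = "top_level p"
    define b where "b = (\<integral>\<omega>. approx A p ?L (\<lambda>j. Y j \<omega>) - F \<omega> \<partial>M)"
    define H where "H = mesh_width p ?L powr \<alpha>"
    define S where "S = real (trunc_dim p ?L) powr (- \<alpha>')"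
    define V where "V = (\<Sum>l = 0..?L. variance_rate \<beta> \<beta>' lam p l)"
    have squares: "H\<^sup>2 = mesh_width p ?L powr (2 * \<alpha>)"
        "S\<^sup>2 = real (trunc_dim p ?L) powr (- 2 * \<alpha>')"
      by (simp_all add: H_def S_def power2_eq_square flip: powr_add)
    have bias: "(\<Sum>l = 0..?L. expected_diff M Y A p l) - (\<integral>\<omega>. F \<omega> \<partial>M) = b"
      using A_integrable[OF p] F by (simp add: sum_expected_diff b_def)
    have "b\<^sup>2 \<le> (c1 * (H + S))\<^sup>2"
      using power_mono[OF c1(2)[OF p], of 2] by (simp add: b_def H_def S_def)
    also have "\<dots> = c1\<^sup>2 * (H + S)\<^sup>2"
      by (simp add: power_mult_distrib)
    also have "\<dots> \<le> c1\<^sup>2 * (2 * (H\<^sup>2 + S\<^sup>2))"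
      using sum_squares_bound[of H S] by (intro mult_left_mono) (simp_all add: power2_sum)
    finally have b2: "b\<^sup>2 \<le> 2 * c1\<^sup>2 * (H\<^sup>2 + S\<^sup>2)"
      by (simp add: algebra_simps)
    have V: "0 \<le> V"
      unfolding V_def by (intro sum_nonneg variance_rate_nonneg)
    \<comment> \<open>The finiteness required by the decomposition follows from (M2), whose
      right-hand side is the embedding of a real number.\<close>
    have "(ml_rmse M F A p)\<^sup>2 = (\<Sum>l = 0..?L. level_variance M Y A p l) + ennreal (b\<^sup>2)"
      unfolding ml_rmse_def ennreal_sqrt_power2 level_variance_def bias[symmetric]
      by (rule mean_square_dev_ml_estimator[OF valid[OF p] A_measurable[OF p] unbiased[OF p]])
         (use c2(2)[OF p] ennreal_less_top in
           \<open>auto simp only: level_variance_def intro: le_less_trans\<close>)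
    also have "\<dots> \<le> (\<Sum>l = 0..?L. ennreal (c2 * variance_rate \<beta> \<beta>' lam p l)) + ennreal (b\<^sup>2)"
      using c2(2)[OF p] by (intro add_right_mono sum_mono) auto
    also have "\<dots> = ennreal (c2 * V + b\<^sup>2)"
      using c2(1) V by (simp add: V_def variance_rate_nonneg sum_distrib_left[symmetric])
    also have "\<dots> \<le> ennreal ((2 * c1\<^sup>2 + c2) * (H\<^sup>2 + S\<^sup>2 + V))"
    proof (rule ennreal_leI)
      \<comment> \<open>These are the cross terms left over when the product of the constant and the
        full sum is expanded.\<close>
      have "0 \<le> c2 * (H\<^sup>2 + S\<^sup>2) + 2 * c1\<^sup>2 * V"
        using c2(1) V by simp
      then show "c2 * V + b\<^sup>2 \<le> (2 * c1\<^sup>2 + c2) * (H\<^sup>2 + S\<^sup>2 + V)"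
        using b2 by (simp add: algebra_simps)
    qed
    finally show "(ml_rmse M F A p)\<^sup>2
        \<le> ennreal ((2 * c1\<^sup>2 + c2) * (mesh_width p (top_level p) powr (2 * \<alpha>)
            + real (trunc_dim p (top_level p)) powr (- 2 * \<alpha>')
            + (\<Sum>l = 0..top_level p. variance_rate \<beta> \<beta>' lam p l)))"
      by (simp only: squares V_def)
  qed
  \<comment> \<open>The constant of (M3) serves unchanged, by summing over the levels.\<close>
  show "\<exists>c>0. \<forall>p\<in>P. ml_cost p \<le> c * (\<Sum>l = 0..top_level p. cost_rate d \<gamma> p l)"
    using M3 unfolding ml_cost_def sum_distrib_left by (meson atLeastAtMost_iff sum_mono)
qed

end
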